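(* For every $k\ge2$, $$\mathcal F_{k^2}=k^2+E_k:=\{k^2+r:r\in E_k\}.$$ Consequently, for every $X<k^2$, $R(X)\le |E_k|$.
   Context: $\mathbb N=\{1,2,3,\dots\}$; $\tau(n)$ is the number of positive divisors of $n$; $T(n)=n+\tau(n)$. For $N\ge2$ the crossing endpoint set is $\mathcal F_N=\{T(m): m\in\mathbb N,\ m<N\le T(m)\}$. For $k\ge2$ the exit set is $$E_k=\{\tau(k^2-j)-j:\ 1\le j\le 2k-2,\ \tau(k^2-j)\ge j\}.$$ $\Gamma$ is the undirected graph with vertex set $\mathbb N$ and edge set $\{\{n,T(n)\}:n\in\mathbb N\}$, and $R(X)$ is the number of connected components of $\Gamma$ meeting $[1,X]$. *)

theory Defs
  imports Complex_Main
begin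

definition tau :: "nat \<Rightarrow> nat" where
  "tau n = card {d. d dvd n}"

definition T :: "nat \<Rightarrow> nat" where
  "T n = n + tau n"

definition crossing_endpoints :: "nat \<Rightarrow> nat set" where
  "crossing_endpoints N = {T m | m. 1 \<le> m \<and> m < N \<and> N \<le> T m}"

text \<open>For \<open>k \<ge> 2\<close> none of the subtractions on \<^typ>\<open>nat\<close> truncates:
  \<open>2 * k - 2 < k\<^sup>2\<close>, and \<open>j \<le> tau (k\<^sup>2 - j)\<close> is part of the condition.\<close>

definition exit_set :: "nat \<Rightarrow> nat set" where
  "exit_set k = {tau (k\<^sup>2 - j) - j | j. 1 \<le> j \<and> j \<le> 2 * k - 2 \<and> j \<le> tau (k\<^sup>2 - j)}"

text \<open>The graph lives on the positive integers, so \<open>0\<close> is excluded explicitly.\<close>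

definition Gamma_verts :: "nat set" where
  "Gamma_verts = {n. 1 \<le> n}"

definition Gamma_edges :: "nat set set" where
  "Gamma_edges = {{n, T n} | n. n \<in> Gamma_verts}"

definition Gamma_connected :: "(nat \<times> nat) set" where
  "Gamma_connected = {(u, v). {u, v} \<in> Gamma_edges}\<^sup>* \<inter> Gamma_verts \<times> Gamma_verts"

definition Gamma_components :: "nat set set" where
  "Gamma_components = Gamma_verts // Gamma_connected"

text \<open>\<open>X\<close> is a real cutoff. Components are disjoint and only finitely many integers
  lie in \<open>[1, X]\<close>, so the cardinality is that of a finite set.\<close>

definition R :: "real \<Rightarrow> nat" where
  "R X = card {C \<in> Gamma_components. \<exists>n\<in>C. real n \<in> {1..X}}"

end

theory Submission
  imports Defs
begin

text \<open>
  Two facts carry the proof.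

  A positive \<open>m < k\<^sup>2\<close> cannot be a product of two factors that are both at least \<open>k\<close>, so each
  divisor of \<open>m\<close> or its codivisor is one of \<open>1, \<dots>, k - 1\<close>, and \<open>tau m \<le> 2 * k - 2\<close>.  Hence a
  step of \<open>T\<close> that reaches or passes \<open>k\<^sup>2\<close> from below starts at \<open>m = k\<^sup>2 - j\<close> with \<open>1 \<le> j \<le> 2 * k - 2\<close>, and it
  ends at \<open>m + tau m = k\<^sup>2 + (tau (k\<^sup>2 - j) - j)\<close>: the endpoints are the translates by \<open>k\<^sup>2\<close> of
  the exits (\<open>tau_less_square_bound\<close>, \<open>crossing_endpoints_square\<close>).

  Since \<open>tau n \<ge> 1\<close>, the orbit of every positive \<open>n < N\<close> under \<open>T\<close> strictly
  increases, and so some step of it reaches or passes \<open>N\<close>.  That step lands on an element of \<open>crossing_endpoints N\<close> that lies in the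
  component of \<open>n\<close> (\<open>orbit_reaches_crossing_endpoint\<close>).  So each component meeting \<open>[1, X]\<close> with
  \<open>X < N\<close> is the component of a crossing endpoint, and there are at most as many such components
  as crossing endpoints (\<open>R_le_card_crossing_endpoints\<close>).
\<close>

lemma tau_pos:
  assumes "n \<ge> 1"
  shows "tau n \<ge> 1"
proof -
  have "{d. d dvd n} \<noteq> {}" by blast
  then show ?thesis
    using assms by (simp add: tau_def Suc_le_eq card_gt_0_iff)
qed

text \<open>The codivisor map \<open>d \<mapsto> n div d\<close> sends the divisors that are at least \<open>k\<close> to numbers below
  \<open>k\<close>, so the divisors are covered by \<open>{1..<k}\<close> and the image of \<open>{1..<k}\<close> under this map.\<close>

lemma tau_less_square_bound:
  assumes "1 \<le> n" "n < k\<^sup>2"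
  shows "tau n \<le> 2 * k - 2"
proof -
  have "{d. d dvd n} \<subseteq> {1..<k} \<union> (\<lambda>e. n div e) ` {1..<k}"
  proof
    fix d assume "d \<in> {d. d dvd n}"
    then obtain e where n: "n = d * e" by blast
    have pos: "1 \<le> d" "1 \<le> e" using assms(1) n by (simp_all add: Suc_le_eq)
    have "d < k \<or> e < k"
    proof (rule ccontr)
      assume "\<not> (d < k \<or> e < k)"
      then have "k * k \<le> d * e" by (intro mult_le_mono) auto
      then show False using assms(2) n by (simp add: power2_eq_square)
    qed
    moreover have "d = n div e" using n pos by simp
    ultimately show "d \<in> {1..<k} \<union> (\<lambda>e. n div e) ` {1..<k}" using pos by auto
  qed
  then have "tau n \<le> card ({1..<k} \<union> (\<lambda>e. n div e) ` {1..<k})"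
    unfolding tau_def by (intro card_mono) auto
  also have "\<dots> \<le> card {1..<k} + card ((\<lambda>e. n div e) ` {1..<k})"
    by (rule card_Un_le)
  also have "\<dots> \<le> (k - 1) + (k - 1)"
    using card_image_le[of "{1..<k}" "\<lambda>e. n div e"] by simp
  finally show ?thesis by simp
qed

lemma crossing_endpoints_square:
  assumes "k \<ge> 2"
  shows "crossing_endpoints (k\<^sup>2) = {k\<^sup>2 + r | r. r \<in> exit_set k}"
proof (intro equalityI subsetI)
  fix p assume "p \<in> crossing_endpoints (k\<^sup>2)"
  then obtain m where m: "p = T m" "1 \<le> m" "m < k\<^sup>2" "k\<^sup>2 \<le> T m"
    unfolding crossing_endpoints_def by blast
  define j where "j = k\<^sup>2 - m"
  have j: "m = k\<^sup>2 - j" "1 \<le> j" "j \<le> tau m"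
    using m by (auto simp: j_def T_def)
  have "tau m - j \<in> exit_set k"
    using j tau_less_square_bound[OF m(2,3)] unfolding exit_set_def by auto
  moreover have "p = k\<^sup>2 + (tau m - j)"
    using m j by (simp add: T_def)
  ultimately show "p \<in> {k\<^sup>2 + r | r. r \<in> exit_set k}" by blast
next
  fix p assume "p \<in> {k\<^sup>2 + r | r. r \<in> exit_set k}"
  then obtain j where j: "p = k\<^sup>2 + (tau (k\<^sup>2 - j) - j)" "1 \<le> j" "j \<le> 2 * k - 2"
      "j \<le> tau (k\<^sup>2 - j)"
    unfolding exit_set_def by blast
  have "2 * k \<le> k\<^sup>2" using assms by (simp add: power2_eq_square)
  then have "j < k\<^sup>2" using j(3) assms by linarith
  then have "p = T (k\<^sup>2 - j)" "1 \<le> k\<^sup>2 - j" "k\<^sup>2 - j < k\<^sup>2" "k\<^sup>2 \<le> T (k\<^sup>2 - j)"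
    using j by (auto simp: T_def)
  then show "p \<in> crossing_endpoints (k\<^sup>2)"
    unfolding crossing_endpoints_def by blast
qed

lemma equiv_Gamma_connected: "equiv Gamma_verts Gamma_connected"
proof (rule equivI)
  have "sym {(u, v). {u, v} \<in> Gamma_edges}"
    by (auto simp: sym_def insert_commute)
  then show "sym Gamma_connected"
    unfolding Gamma_connected_def
    by (intro sym_Int sym_rtrancl) (auto simp: sym_def)
  show "trans Gamma_connected"
    unfolding Gamma_connected_def
    by (intro trans_Int trans_rtrancl) (auto simp: trans_def)
qed (auto simp: Gamma_connected_def refl_on_def)

lemma Gamma_connected_T:
  assumes "n \<ge> 1"
  shows "(n, T n) \<in> Gamma_connected"
proof -
  have "{n, T n} \<in> Gamma_edges"
    using assms by (auto simp: Gamma_edges_def Gamma_verts_def)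
  then show ?thesis
    using assms by (auto simp: Gamma_connected_def Gamma_verts_def T_def)
qed

lemma finite_crossing_endpoints: "finite (crossing_endpoints N)"
proof -
  have "crossing_endpoints N \<subseteq> T ` {..<N}"
    unfolding crossing_endpoints_def by auto
  then show ?thesis by (rule finite_subset) simp
qed

lemma orbit_reaches_crossing_endpoint:
  assumes "1 \<le> n" "n < N"
  shows "\<exists>p \<in> crossing_endpoints N. (n, p) \<in> Gamma_connected"
  using assms
proof (induction "N - n" arbitrary: n rule: less_induct)
  case less
  show ?case
  proof (cases "N \<le> T n")
    case True
    then have "T n \<in> crossing_endpoints N"
      using less.prems unfolding crossing_endpoints_def by blast
    then show ?thesis using Gamma_connected_T less.prems(1) by blast
  next
    case False
    have "n < T n" using tau_pos[OF less.prems(1)] by (simp add: T_def)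
    then have "N - T n < N - n" "1 \<le> T n" "T n < N"
      using less.prems False by linarith+
    then obtain p where "p \<in> crossing_endpoints N" "(T n, p) \<in> Gamma_connected"
      using less.hyps by blast
    then show ?thesis
      using Gamma_connected_T[OF less.prems(1)] equiv_Gamma_connected
      by (meson equivE transD)
  qed
qed

lemma R_le_card_crossing_endpoints:
  fixes X :: real
  assumes "X < real N"
  shows "R X \<le> card (crossing_endpoints N)"
proof -
  have "{C \<in> Gamma_components. \<exists>n\<in>C. real n \<in> {1..X}}
      \<subseteq> (\<lambda>p. Gamma_connected `` {p}) ` crossing_endpoints N"
  proof
    fix C assume "C \<in> {C \<in> Gamma_components. \<exists>n\<in>C. real n \<in> {1..X}}"
    then obtain n where C: "C \<in> Gamma_verts // Gamma_connected" "n \<in> C"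
        and n: "1 \<le> real n" "real n \<le> X"
      unfolding Gamma_components_def by auto
    from n assms have "1 \<le> n" "n < N" by linarith+
    then obtain p where p: "p \<in> crossing_endpoints N" "(n, p) \<in> Gamma_connected"
      using orbit_reaches_crossing_endpoint by blast
    have "C = Gamma_connected `` {n}"
      using C equiv_Gamma_connected
      by (metis Image_singleton_iff equiv_class_eq_iff quotientE)
    also have "\<dots> = Gamma_connected `` {p}"
      using equiv_class_eq[OF equiv_Gamma_connected p(2)] .
    finally show "C \<in> (\<lambda>p. Gamma_connected `` {p}) ` crossing_endpoints N"
      using p(1) by blast
  qed
  then show ?thesis
    unfolding R_def using finite_crossing_endpoints by (rule surj_card_le[rotated])
qed

theorem proposition5p4:
  fixes k :: nat
  assumes "k \<ge> 2"
  shows "crossing_endpoints (k\<^sup>2) = {k\<^sup>2 + r | r. r \<in> exit_set k} \<and>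
    (\<forall>X::real. X < real (k\<^sup>2) \<longrightarrow> R X \<le> card (exit_set k))"
proof -
  note endpoints = crossing_endpoints_square[OF assms]
  then have "crossing_endpoints (k\<^sup>2) = (\<lambda>r. k\<^sup>2 + r) ` exit_set k" by blast
  then have "card (crossing_endpoints (k\<^sup>2)) = card (exit_set k)"
    by (simp add: card_image)
  then show ?thesis
    using endpoints R_le_card_crossing_endpoints by metis
qed

end
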